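(* Let $\{X_n\}_{n=0}^{\infty}$ be a centered real Gaussian process with covariance matrix $K$. If $K$ is bounded on $\ell^2$, then $\{X_n\}_{n=0}^{\infty}$ has the $L$-property; that is, for every $p$ with $0<p<\infty$ and every $f(z)=\sum_{n=0}^\infty a_nz^n\in H^2$, one has $\sum_{n=0}^\infty a_nX_nz^n\in H^p$ almost surely.
   Context: $\mathbb{D}$ is the open unit disk in $\mathbb{C}$, and $H^p=H^p(\mathbb{D})$, $0<p<\infty$, is the Hardy space of analytic functions on $\mathbb{D}$; $H^2$ consists of the series $\sum_{n\ge0} a_nz^n$ with complex coefficients $\{a_n\}\in\ell^2$. A real Gaussian process $\{X_n\}_{n=0}^\infty$ is a sequence of real random variables on a common probability space which is jointly Gaussian (every finite linear combination is a Gaussian variable, possibly degenerate); independence is not assumed. It is centered if $\mathbb{E}X_n=0$ for all $n\ge0$. Its covariance matrix is $K=\big(\mathbb{E}((X_m-\mathbb{E}X_m)(X_n-\mathbb{E}X_n))\big)_{n,m\ge0}$; "$K$ is bounded on $\ell^2$" means that this infinite matrix defines a bounded linear operator on $\ell^2$. A sequence of random variables $\{X_n\}_{n=0}^\infty$ has the $L_p$-property if for any $f(z)=\sum_{n=0}^\infty a_nz^n\in H^2$ one has $\sum_{n=0}^\infty a_nX_nz^n\in H^p$ almost surely. It has the $L$-property if it has the $L_p$-property for all $p>0$ ($p$ finite). *)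

theory Defs
  imports "HOL-Probability.Probability" "HOL-Complex_Analysis.Complex_Analysis"
begin

text \<open>Membership constrains a function only on the open unit disk; its values elsewhere are
  irrelevant. For \<open>p > 0\<close> the integrand is continuous in \<open>t\<close>, so the Bochner integral below is never a
  default value.\<close>

definition hardy_space :: "real \<Rightarrow> (complex \<Rightarrow> complex) set" where
  "hardy_space p = {f. f holomorphic_on ball 0 1 \<and>
     bdd_above ((\<lambda>r::real. 1 / (2 * pi) *
        (LINT t:{0..2*pi}|lborel. norm (f (of_real r * cis t)) powr p)) ` {0<..<1})}"

definition gaussian_variable :: "'a measure \<Rightarrow> ('a \<Rightarrow> real) \<Rightarrow> bool" where
  "gaussian_variable M Y \<longleftrightarrow> Y \<in> borel_measurable M \<and>
     ((\<exists>\<mu> \<sigma>. 0 < \<sigma> \<and> distributed M lborel Y (normal_density \<mu> \<sigma>)) \<or>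
      (\<exists>\<mu>. AE \<omega> in M. Y \<omega> = \<mu>))"

definition gaussian_process :: "'a measure \<Rightarrow> (nat \<Rightarrow> 'a \<Rightarrow> real) \<Rightarrow> bool" where
  "gaussian_process M X \<longleftrightarrow>
     (\<forall>I c. finite I \<longrightarrow> gaussian_variable M (\<lambda>\<omega>. \<Sum>n\<in>I. c n * X n \<omega>))"

definition centered :: "'a measure \<Rightarrow> (nat \<Rightarrow> 'a \<Rightarrow> real) \<Rightarrow> bool" where
  "centered M X \<longleftrightarrow> (\<forall>n. integral\<^sup>L M (X n) = 0)"

definition covariance_matrix :: "'a measure \<Rightarrow> (nat \<Rightarrow> 'a \<Rightarrow> real) \<Rightarrow> nat \<Rightarrow> nat \<Rightarrow> real" where
  "covariance_matrix M X n m =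
     (LINT \<omega>|M. (X m \<omega> - integral\<^sup>L M (X m)) * (X n \<omega> - integral\<^sup>L M (X n)))"

definition ell2 :: "(nat \<Rightarrow> complex) set" where
  "ell2 = {x. summable (\<lambda>n. (norm (x n))\<^sup>2)}"

definition ell2_norm :: "(nat \<Rightarrow> complex) \<Rightarrow> real" where
  "ell2_norm x = sqrt (\<Sum>n. (norm (x n))\<^sup>2)"

text \<open>Convergence of every row sum is part of the definition, since \<open>suminf\<close> is total;
  linearity of the operator is then automatic.\<close>

definition bounded_on_ell2 :: "(nat \<Rightarrow> nat \<Rightarrow> real) \<Rightarrow> bool" where
  "bounded_on_ell2 K \<longleftrightarrow> (\<exists>C. \<forall>x\<in>ell2.
     (\<forall>n. summable (\<lambda>m. of_real (K n m) * x m)) \<and>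
     (\<lambda>n. \<Sum>m. of_real (K n m) * x m) \<in> ell2 \<and>
     ell2_norm (\<lambda>n. \<Sum>m. of_real (K n m) * x m) \<le> C * ell2_norm x)"

text \<open>The exceptional null set may depend on \<open>f\<close> (and on \<open>p\<close>). Convergence of the random
  series on the whole disk is part of the conclusion.\<close>

definition Lp_property :: "real \<Rightarrow> 'a measure \<Rightarrow> (nat \<Rightarrow> 'a \<Rightarrow> real) \<Rightarrow> bool" where
  "Lp_property p M X \<longleftrightarrow>
     (\<forall>f a. f \<in> hardy_space 2 \<and> (\<forall>z\<in>ball 0 1. (\<lambda>n. a n * z ^ n) sums f z) \<longrightarrow>
       (AE \<omega> in M. \<exists>g\<in>hardy_space p.
          \<forall>z\<in>ball 0 1. (\<lambda>n. a n * of_real (X n \<omega>) * z ^ n) sums g z))"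

definition L_property :: "'a measure \<Rightarrow> (nat \<Rightarrow> 'a \<Rightarrow> real) \<Rightarrow> bool" where
  "L_property M X \<longleftrightarrow> (\<forall>p>0. Lp_property p M X)"

end

theory Submission imports Defs begin

text \<open>Every finite linear combination of the \<open>X n\<close> is Gaussian, so boundedness of the covariance
  matrix controls all its even moments by powers of the \<open>ell2\<close> norm of the coefficients. By Fatou,
  the \<open>2 k\<close>-th moments of the random series are bounded uniformly on the disk, and by
  Tonelli so are the expected \<open>2 k\<close>-th integral means over circles. The means are increasing in the radius
  (Parseval applied to the \<open>k\<close>-th power of the function), so Fatou along radii tending to \<open>1\<close> shows that
  they are almost surely bounded.\<close>

section \<open>Integral means on circles\<close>

text \<open>For nonzero \<open>j\<close> the antiderivative \<open>cis (j * t) / (\<i> * j)\<close>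
  has period \<open>2*pi\<close>, so its increment vanishes. The frequency is an integer because
  differences of indices occur when a square is expanded.\<close>

lemma has_bochner_integral_cis_int:
  fixes j :: int
  shows "has_bochner_integral lborel (\<lambda>t. indicator {0..2*pi} t *\<^sub>R cis (of_int j * t))
           (if j = 0 then 2 * of_real pi else 0)"
proof (cases "j = 0")
  case True
  then show ?thesis
    using has_bochner_integral_FTC_Icc[of 0 "2*pi" "\<lambda>t. of_real t :: complex" "\<lambda>t. 1"]
    by (force intro!: derivative_eq_intros)
next
  case False
  define F where "F z = exp (\<i> * of_int j * z) / (\<i> * of_int j)" for z :: complex
  have F: "F (of_real t) = cis (of_int j * t) / (\<i> * of_int j)" for t
    by (simp add: F_def cis_conv_exp mult_ac)
  have "(F has_field_derivative exp (\<i> * of_int j * z)) (at z)" for z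
    unfolding F_def using False by (auto intro!: derivative_eq_intros)
  from has_vector_derivative_real_field[OF this]
  have "((\<lambda>t. F (of_real t)) has_vector_derivative cis (of_int j * t)) (at t within {0..2*pi})" for t
    by (simp add: cis_conv_exp mult_ac)
  then have "has_bochner_integral lborel (\<lambda>t. indicator {0..2*pi} t *\<^sub>R cis (of_int j * t))
     (F (of_real (2*pi)) - F (of_real 0))"
    by (intro has_bochner_integral_FTC_Icc) (auto intro!: continuous_intros)
  moreover have "cis (of_int j * (2*pi)) = 1"
    using cis_multiple_2pi[of "of_int j"] by (simp add: mult_ac)
  ultimately show ?thesis using False unfolding F by simp
qed

text \<open>Finite Parseval identity: expanding the square as a double sum, orthogonality of the
  exponentials leaves only the diagonal.\<close>

lemma set_integral_norm_trig_sum: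
  fixes c :: "nat \<Rightarrow> complex"
  shows "(LINT t:{0..2*pi}|lborel. (norm (\<Sum>n<N. c n * cis (real n * t)))\<^sup>2)
           = 2 * pi * (\<Sum>n<N. (norm (c n))\<^sup>2)"
proof -
  have eq: "complex_of_real ((norm (\<Sum>n<N. c n * cis (real n * t)))\<^sup>2)
      = (\<Sum>n<N. \<Sum>m<N. c n * cnj (c m) * cis (of_int (int n - int m) * t))" for t
  proof -
    have "cis (real n * t) * cis (- (real m * t)) = cis (of_int (int n - int m) * t)" for n m
      by (simp add: cis_mult algebra_simps)
    then show ?thesis
      unfolding complex_norm_square
      by (simp add: sum_product cis_cnj mult_ac)
  qed
  have "has_bochner_integral lborel
      (\<lambda>t. \<Sum>n<N. \<Sum>m<N. c n * cnj (c m) * (indicator {0..2*pi} t *\<^sub>R cis (of_int (int n - int m) * t)))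
      (\<Sum>n<N. \<Sum>m<N. c n * cnj (c m) * (if int n - int m = 0 then 2 * of_real pi else 0))"
    by (intro has_bochner_integral_sum has_bochner_integral_mult_right has_bochner_integral_cis_int)
  moreover have "(\<Sum>n<N. \<Sum>m<N. c n * cnj (c m) * (if int n - int m = 0 then 2 * of_real pi else 0))
      = of_real (2 * pi * (\<Sum>n<N. (norm (c n))\<^sup>2))"
    by (simp add: if_distrib[of "\<lambda>x. _ * x"] sum.delta sum_distrib_left complex_norm_square
        mult_ac del: of_real_power cong: if_cong)
  ultimately have "(LINT t:{0..2*pi}|lborel. complex_of_real ((norm (\<Sum>n<N. c n * cis (real n * t)))\<^sup>2))
      = of_real (2 * pi * (\<Sum>n<N. (norm (c n))\<^sup>2))"
    unfolding set_lebesgue_integral_def eq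
    by (subst has_bochner_integral_integral_eq[symmetric])
       (auto simp: scaleR_sum_right mult_scaleR_right)
  then show ?thesis
    unfolding set_integral_complex_of_real of_real_eq_iff .
qed

text \<open>Limit of the finite identity under dominated convergence: on a circle inside the disk
  the partial sums are bounded by the absolutely convergent series \<open>B\<close>.\<close>

lemma parseval_circle:
  fixes f :: "complex \<Rightarrow> complex"
  assumes f: "\<And>z. z \<in> ball 0 1 \<Longrightarrow> (\<lambda>n. b n * z ^ n) sums f z" and r: "0 \<le> r" "r < 1"
  shows "(\<lambda>n. (norm (b n))\<^sup>2 * r ^ (2 * n)) sums
           (1 / (2 * pi) * (LINT t:{0..2*pi}|lborel. (norm (f (of_real r * cis t)))\<^sup>2))"
proof -
  define s where "s N t = (\<Sum>n<N. (b n * of_real (r ^ n)) * cis (real n * t))" for N t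
  define B where "B = (\<Sum>n. norm (b n) * r ^ n)"
  \<comment> \<open>Convergence at the larger radius \<open>\<rho>\<close> forces absolute
    convergence at \<open>r\<close>.\<close>
  obtain \<rho> where \<rho>: "r < \<rho>" "\<rho> < 1" using dense r(2) by blast
  have "summable (\<lambda>n. b n * of_real \<rho> ^ n)"
    using f[of "of_real \<rho>"] \<rho> r by (auto simp: sums_iff)
  then have "summable (\<lambda>n. norm (b n * of_real r ^ n))"
    by (rule powser_insidea) (use \<rho> r in auto)
  then have sm: "summable (\<lambda>n. norm (b n) * r ^ n)"
    using r by (simp add: norm_mult norm_power)
  have term_eq: "(b n * of_real (r ^ n)) * cis (real n * t) = b n * (of_real r * cis t) ^ n" for n t
    by (simp add: power_mult_distrib Complex.DeMoivre mult_ac)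
  have lim: "(\<lambda>N. s N t) \<longlonglongrightarrow> f (of_real r * cis t)" for t
    using f[of "of_real r * cis t"] r
    by (simp add: s_def term_eq sums_def norm_mult del: of_real_power)
  have bound: "norm (s N t) \<le> B" for N t
  proof -
    have "norm (s N t) \<le> (\<Sum>n<N. norm (b n) * r ^ n)"
      unfolding s_def using r by (intro sum_norm_le) (simp add: norm_mult norm_power)
    also have "\<dots> \<le> B"
      unfolding B_def using r by (intro sum_le_suminf sm) auto
    finally show ?thesis .
  qed
  have meas [measurable]: "s N \<in> borel_measurable borel" for N
    unfolding s_def by (intro borel_measurable_continuous_onI continuous_intros)
  have measf [measurable]: "(\<lambda>t. f (of_real r * cis t)) \<in> borel_measurable borel"
    by (rule borel_measurable_LIMSEQ_metric[OF meas lim])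
  have "(\<lambda>N. LINT t:{0..2*pi}|lborel. (norm (s N t))\<^sup>2)
      \<longlonglongrightarrow> (LINT t:{0..2*pi}|lborel. (norm (f (of_real r * cis t)))\<^sup>2)"
    unfolding set_lebesgue_integral_def
  proof (rule integral_dominated_convergence[where w = "\<lambda>t. indicator {0..2*pi} t *\<^sub>R B\<^sup>2"])
    show "integrable lborel (\<lambda>t. indicator {0..2*pi} t *\<^sub>R B\<^sup>2)"
      by (rule integrable_scaleR_left) auto
    show "AE t in lborel. (\<lambda>N. indicator {0..2*pi} t *\<^sub>R (norm (s N t))\<^sup>2)
        \<longlonglongrightarrow> indicator {0..2*pi} t *\<^sub>R (norm (f (of_real r * cis t)))\<^sup>2"
      by (intro AE_I2 tendsto_intros lim)
    show "AE t in lborel. norm (indicator {0..2*pi} t *\<^sub>R (norm (s N t))\<^sup>2)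
        \<le> indicator {0..2*pi} t *\<^sub>R B\<^sup>2" for N
      by (auto simp: indicator_def intro!: power_mono bound)
  qed measurable
  then have "(\<lambda>N. 1 / (2*pi) * (2 * pi * (\<Sum>n<N. (norm (b n * of_real (r ^ n)))\<^sup>2)))
      \<longlonglongrightarrow> 1 / (2*pi) * (LINT t:{0..2*pi}|lborel. (norm (f (of_real r * cis t)))\<^sup>2)"
    unfolding s_def set_integral_norm_trig_sum by (intro tendsto_intros)
  moreover have "1 / (2*pi) * (2 * pi * (\<Sum>n<N. (norm (b n * of_real (r ^ n)))\<^sup>2))
      = (\<Sum>n<N. (norm (b n))\<^sup>2 * r ^ (2 * n))" for N
    using r by (simp add: norm_mult norm_power power_mult_distrib mult.commute flip: power_mult)
  ultimately show ?thesis unfolding sums_def by simp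
qed

text \<open>By Parseval the Hardy bound dominates every partial sum weighted by
  \<open>r ^ (2 * n)\<close>. With the number of terms fixed, letting \<open>r\<close> tend to 1
  removes the weights.\<close>

lemma hardy_space_2_coeffs_ell2:
  assumes "f \<in> hardy_space 2" "\<And>z. z \<in> ball 0 1 \<Longrightarrow> (\<lambda>n. a n * z ^ n) sums f z"
  shows "a \<in> ell2"
proof -
  obtain B where B: "\<And>r. r \<in> {0<..<1} \<Longrightarrow>
      1 / (2 * pi) * (LINT t:{0..2*pi}|lborel. norm (f (of_real r * cis t)) powr 2) \<le> B"
    using assms(1) unfolding hardy_space_def bdd_above_def by blast
  have "(\<Sum>n<N. (norm (a n))\<^sup>2) \<le> B" for N
  proof (rule tendsto_upperbound)
    show "((\<lambda>r. \<Sum>n<N. (norm (a n))\<^sup>2 * r ^ (2 * n)) \<longlongrightarrow> (\<Sum>n<N. (norm (a n))\<^sup>2)) (at_left 1)"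
      by (auto intro!: tendsto_eq_intros)
    have "(\<Sum>n<N. (norm (a n))\<^sup>2 * r ^ (2 * n)) \<le> B" if r: "0 < r" "r < 1" for r
    proof -
      have p: "(\<lambda>n. (norm (a n))\<^sup>2 * r ^ (2 * n)) sums
           (1 / (2 * pi) * (LINT t:{0..2*pi}|lborel. (norm (f (of_real r * cis t)))\<^sup>2))"
        using r by (intro parseval_circle assms) auto
      then have "(\<Sum>n<N. (norm (a n))\<^sup>2 * r ^ (2 * n)) \<le> (\<Sum>n. (norm (a n))\<^sup>2 * r ^ (2 * n))"
        using r by (intro sum_le_suminf) (auto simp: sums_iff)
      with p B[of r] r show ?thesis by (simp add: sums_iff)
    qed
    then show "\<forall>\<^sub>F r in at_left 1. (\<Sum>n<N. (norm (a n))\<^sup>2 * r ^ (2 * n)) \<le> B"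
      by (auto simp: eventually_at_left_field intro!: exI[of _ 0])
  qed simp
  then show ?thesis
    unfolding ell2_def mem_Collect_eq
    by (intro bounded_imp_summable[where B = B]) (simp_all only: zero_le_power2 flip: lessThan_Suc_atMost)
qed

text \<open>Since \<open>2 * k\<close> is even, the integrand is the squared modulus of the
  holomorphic function \<open>f ^ k\<close>. Parseval turns its mean into a power series in the
  radius with nonnegative coefficients, which replaces an appeal to subharmonicity.\<close>

lemma integral_mean_even_mono:
  assumes f: "f holomorphic_on ball 0 1" and r: "0 \<le> r" "r \<le> s" "s < 1"
  shows "(LINT t:{0..2*pi}|lborel. norm (f (of_real r * cis t)) ^ (2 * k))
           \<le> (LINT t:{0..2*pi}|lborel. norm (f (of_real s * cis t)) ^ (2 * k))"
proof -
  define b where "b n = (deriv ^^ n) (\<lambda>z. f z ^ k) 0 / fact n" for n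
  have "(\<lambda>z. f z ^ k) holomorphic_on ball 0 1" by (intro holomorphic_intros f)
  from holomorphic_power_series[OF this]
  have b: "(\<lambda>n. b n * z ^ n) sums (f z ^ k)" if "z \<in> ball 0 1" for z
    using that unfolding b_def by force
  have sq: "(norm (z ^ k))\<^sup>2 = norm z ^ (2 * k)" for z :: complex
    by (simp add: norm_power mult.commute flip: power_mult)
  have "(\<Sum>n. (norm (b n))\<^sup>2 * r ^ (2 * n)) \<le> (\<Sum>n. (norm (b n))\<^sup>2 * s ^ (2 * n))"
    using r parseval_circle[OF b, of r] parseval_circle[OF b, of s]
    by (intro suminf_le mult_left_mono power_mono) (auto simp: sums_iff)
  moreover have "(LINT t:{0..2*pi}|lborel. norm (f (of_real u * cis t)) ^ (2 * k))
      = 2 * pi * (\<Sum>n. (norm (b n))\<^sup>2 * u ^ (2 * n))" if "0 \<le> u" "u < 1" for u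
    using parseval_circle[OF b, of u] that by (simp add: sums_iff sq)
  ultimately show ?thesis
    using r by simp
qed

text \<open>The integrand is continuous on a compact interval. The function \<open>h\<close> covers
  both real powers \<open>powr p\<close> and natural powers; continuity on the nonnegative half-line
  suffices, as norms lie there.\<close>

lemma set_integrable_norm_circle:
  fixes h :: "real \<Rightarrow> real"
  assumes f: "f holomorphic_on ball 0 1" and r: "0 \<le> r" "r < 1"
    and h: "continuous_on {0..} h"
  shows "set_integrable lborel {0..2*pi} (\<lambda>t. h (norm (f (of_real r * cis t))))"
proof (rule borel_integrable_atLeastAtMost')
  note cf = holomorphic_on_imp_continuous_on[OF f]
  have "continuous_on {0..2*pi} (\<lambda>t. f (of_real r * cis t))"
    using r by (intro continuous_on_compose2[OF cf] continuous_intros) (auto simp: norm_mult)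
  then show "continuous_on {0..2*pi} (\<lambda>t. h (norm (f (of_real r * cis t))))"
    by (intro continuous_on_compose2[OF h] continuous_on_norm) auto
qed

text \<open>Pointwise \<open>x powr p \<le> 1 + x ^ (2 * k)\<close> for nonnegative
  \<open>x\<close>, so an even mean of higher order controls the mean of order
  \<open>p\<close>.\<close>

lemma hardy_spaceI_even_means:
  assumes f: "f holomorphic_on ball 0 1" and p: "0 < p" "p \<le> real (2 * k)"
    and B: "\<And>r. 0 < r \<Longrightarrow> r < 1 \<Longrightarrow>
      (LINT t:{0..2*pi}|lborel. norm (f (of_real r * cis t)) ^ (2 * k)) \<le> B"
  shows "f \<in> hardy_space p"
proof -
  have "(LINT t:{0..2*pi}|lborel. norm (f (of_real r * cis t)) powr p) \<le> 2 * pi + B"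
    if r: "0 < r" "r < 1" for r
  proof -
    have le: "x powr p \<le> 1 + x ^ (2 * k)" if "0 \<le> x" for x :: real
    proof (cases "x \<le> 1")
      case True
      then have "x powr p \<le> 1 powr p" using that p by (intro powr_mono2) auto
      then show ?thesis using that by (simp add: add_increasing2)
    next
      case False
      then have "x powr p \<le> x powr real (2 * k)" using p by (intro powr_mono) auto
      also have "\<dots> = x ^ (2 * k)" using False by (subst powr_realpow) auto
      finally show ?thesis by simp
    qed
    have c: "continuous_on {0..} (\<lambda>x::real. x powr p)"
      using p by (intro continuous_on_powr' continuous_intros) auto
    have int: "set_integrable lborel {0..2*pi} (\<lambda>t. norm (f (of_real r * cis t)) ^ (2 * k))"
      using r by (intro set_integrable_norm_circle[OF f, where h = "\<lambda>x. x ^ (2 * k)"]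
          continuous_intros) auto
    have one: "set_integrable lborel {0..2*pi} (\<lambda>t. 1 :: real)"
      by (intro borel_integrable_atLeastAtMost' continuous_intros)
    have "(LINT t:{0..2*pi}|lborel. norm (f (of_real r * cis t)) powr p)
        \<le> (LINT t:{0..2*pi}|lborel. 1 + norm (f (of_real r * cis t)) ^ (2 * k))"
      using r by (intro set_integral_mono set_integral_add one int le
          set_integrable_norm_circle[OF f _ _ c]) auto
    also have "\<dots> = (LINT t:{0..2*pi}|lborel. 1)
        + (LINT t:{0..2*pi}|lborel. norm (f (of_real r * cis t)) ^ (2 * k))"
      by (intro set_integral_add one int)
    also have "(LINT t:{0..2*pi}|lborel. 1 :: real) = 2 * pi"
      by (simp add: set_lebesgue_integral_def)
    finally show ?thesis using B[OF r] by simp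
  qed
  then have "bdd_above ((\<lambda>r::real. 1 / (2 * pi) *
        (LINT t:{0..2*pi}|lborel. norm (f (of_real r * cis t)) powr p)) ` {0<..<1})"
    by (intro bdd_aboveI2[where M = "1 / (2 * pi) * (2 * pi + B)"] mult_left_mono) auto
  then show ?thesis using f by (simp add: hardy_space_def)
qed

section \<open>Moments of Gaussian processes\<close>

text \<open>Cauchy-Schwarz applied to the pairing of \<open>c\<close> with its image under
  \<open>K\<close>, after \<open>c\<close> has been cut off to finitely many entries. Taking
  \<open>\<bar>C\<bar>\<close> makes the constant visibly nonnegative.\<close>

lemma bounded_on_ell2_quadratic_form:
  assumes "bounded_on_ell2 K"
  obtains C where "0 \<le> C"
    "\<And>(c :: nat \<Rightarrow> real) N. (\<Sum>n<N. \<Sum>m<N. c n * c m * K n m) \<le> C * (\<Sum>n<N. (c n)\<^sup>2)"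
proof -
  obtain C where C: "\<And>x. x \<in> ell2 \<Longrightarrow> (\<lambda>n. \<Sum>m. of_real (K n m) * x m) \<in> ell2 \<and>
     ell2_norm (\<lambda>n. \<Sum>m. of_real (K n m) * x m) \<le> C * ell2_norm x"
    using assms unfolding bounded_on_ell2_def by blast
  have "(\<Sum>n<N. \<Sum>m<N. c n * c m * K n m) \<le> \<bar>C\<bar> * (\<Sum>n<N. (c n)\<^sup>2)" for c :: "nat \<Rightarrow> real" and N
  proof -
    \<comment> \<open>The cut-off makes every row series a finite sum. The image \<open>y\<close>
      may have infinitely many nonzero entries; only the first \<open>N\<close> meet the support of
      \<open>x\<close>.\<close>
    define x where "x m = (if m < N then complex_of_real (c m) else 0)" for m
    define y where "y n = (\<Sum>m<N. K n m * c m)" for n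
    have sx: "(\<lambda>n. (norm (x n))\<^sup>2) sums (\<Sum>n<N. (c n)\<^sup>2)"
      using sums_finite[of "{..<N}" "\<lambda>n. (norm (x n))\<^sup>2"] by (simp add: x_def)
    have Kx: "(\<lambda>n. \<Sum>m. of_real (K n m) * x m) = (\<lambda>n. complex_of_real (y n))"
    proof
      fix n
      show "(\<Sum>m. of_real (K n m) * x m) = complex_of_real (y n)"
        using suminf_finite[of "{..<N}" "\<lambda>m. of_real (K n m) * x m"] by (simp add: x_def y_def)
    qed
    have x: "x \<in> ell2" "ell2_norm x = L2_set c {..<N}"
      using sx by (auto simp: ell2_def ell2_norm_def L2_set_def sums_iff)
    have y: "summable (\<lambda>n. (y n)\<^sup>2)" "sqrt (\<Sum>n. (y n)\<^sup>2) \<le> C * L2_set c {..<N}"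
      using C[OF x(1)] unfolding Kx x(2) by (auto simp: ell2_def ell2_norm_def)
    have "L2_set y {..<N} \<le> sqrt (\<Sum>n. (y n)\<^sup>2)"
      unfolding L2_set_def by (intro real_sqrt_le_mono sum_le_suminf y) auto
    also have "\<dots> \<le> C * L2_set c {..<N}" by (rule y)
    also have "\<dots> \<le> \<bar>C\<bar> * L2_set c {..<N}" by (intro mult_right_mono) auto
    finally have Ly: "L2_set y {..<N} \<le> \<bar>C\<bar> * L2_set c {..<N}" .
    have "(\<Sum>n<N. \<Sum>m<N. c n * c m * K n m) = (\<Sum>n<N. c n * y n)"
      by (simp add: y_def sum_distrib_left mult_ac)
    also have "\<dots> \<le> (\<Sum>n<N. \<bar>c n\<bar> * \<bar>y n\<bar>)"
      by (intro sum_mono) (metis abs_ge_self abs_mult)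
    also have "\<dots> \<le> L2_set c {..<N} * L2_set y {..<N}"
      by (rule L2_set_mult_ineq)
    also have "\<dots> \<le> L2_set c {..<N} * (\<bar>C\<bar> * L2_set c {..<N})"
      by (intro mult_left_mono Ly) simp
    also have "\<dots> = \<bar>C\<bar> * (L2_set c {..<N})\<^sup>2"
      by (simp add: power2_eq_square mult_ac)
    finally have "(\<Sum>n<N. \<Sum>m<N. c n * c m * K n m) \<le> \<bar>C\<bar> * (L2_set c {..<N})\<^sup>2" .
    then show ?thesis by (simp add: L2_set_def sum_nonneg)
  qed
  then show ?thesis using that[of "\<bar>C\<bar>"] by auto
qed

text \<open>The nondegenerate case is the classical even moment formula with
  \<open>\<mu> = 0\<close>. In the degenerate case the zero mean forces \<open>Y\<close> to vanish
  almost surely.\<close>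

lemma (in prob_space)
  assumes Y: "gaussian_variable M Y" and mean: "expectation Y = 0"
  shows integrable_gaussian_even_power: "integrable M (\<lambda>\<omega>. Y \<omega> ^ (2 * k))" (is ?int)
    and gaussian_even_moment: "expectation (\<lambda>\<omega>. Y \<omega> ^ (2 * k))
      = fact (2 * k) / (2 ^ k * fact k) * expectation (\<lambda>\<omega>. (Y \<omega>)\<^sup>2) ^ k" (is ?eq)
proof -
  have [measurable]: "Y \<in> borel_measurable M" using Y by (simp add: gaussian_variable_def)
  consider (normal) \<mu> \<sigma> where "0 < \<sigma>" "distributed M lborel Y (normal_density \<mu> \<sigma>)"
    | (const) \<mu> where "AE \<omega> in M. Y \<omega> = \<mu>"
    using Y unfolding gaussian_variable_def by blast
  then have "?int \<and> ?eq"
  proof cases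
    case normal
    note D = \<open>distributed M lborel Y (normal_density \<mu> \<sigma>)\<close>
    have \<mu>: "\<mu> = 0" using normal_distributed_expectation[OF normal] mean by simp
    have \<sigma>: "expectation (\<lambda>\<omega>. (Y \<omega>)\<^sup>2) = \<sigma>\<^sup>2"
      using normal_distributed_variance[OF normal] mean by simp
    have h: "has_bochner_integral lborel (\<lambda>x. normal_density \<mu> \<sigma> x * x ^ (2 * k))
        (fact (2 * k) / ((2 / \<sigma>\<^sup>2) ^ k * fact k))"
      using normal_moment_even[OF normal(1), of \<mu> k] by (simp add: \<mu>)
    have ?int
      using distributed_integrable[OF D, of "\<lambda>x. x ^ (2 * k)"] h
      by (auto simp: has_bochner_integral_iff)
    moreover have ?eq
      using distributed_integral[OF D, of "\<lambda>x. x ^ (2 * k)"] h normal(1)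
      by (simp add: has_bochner_integral_iff \<sigma> field_simps)
    ultimately show ?thesis ..
  next
    case const
    then have "expectation Y = expectation (\<lambda>_. \<mu>)" by (intro integral_cong_AE) auto
    then have "\<mu> = 0" using mean by (simp add: prob_space)
    \<comment> \<open>A general exponent \<open>j\<close> serves both the moment of order
      \<open>2 * k\<close> and the variance; at \<open>k = 0\<close> both sides of the formula are 1
      because \<open>0 ^ 0 = 1\<close>.\<close>
    with const have Z: "AE \<omega> in M. Y \<omega> ^ j = 0 ^ j" for j by auto
    have ?int
      by (subst integrable_cong_AE[OF _ _ Z]) auto
    moreover have "expectation (\<lambda>\<omega>. Y \<omega> ^ j) = 0 ^ j" for j
      by (subst integral_cong_AE[OF _ _ Z]) (auto simp: prob_space)
    ultimately show ?thesis by (auto simp: power_0_left)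
  qed
  then show ?int ?eq by auto
qed

section \<open>Moments of finite linear combinations of the process\<close>

lemma gaussian_process_variable: "gaussian_process M X \<Longrightarrow> gaussian_variable M (X n)"
  unfolding gaussian_process_def
  by (drule spec[of _ "{n}"], drule spec[of _ "\<lambda>_. 1"]) simp

locale centered_gaussian_process = prob_space M for M :: "'a measure" +
  fixes X :: "nat \<Rightarrow> 'a \<Rightarrow> real"
  assumes gaussian: "gaussian_process M X" and centered: "centered M X"
begin

lemma measurable_process [measurable]: "X n \<in> borel_measurable M"
  using gaussian_process_variable[OF gaussian] by (simp add: gaussian_variable_def)

lemma integrable_process_square: "integrable M (\<lambda>\<omega>. (X n \<omega>)\<^sup>2)"
  using integrable_gaussian_even_power[OF gaussian_process_variable[OF gaussian], of n 1]
  using centered by (simp add: centered_def)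

lemma integrable_process: "integrable M (X n)"
  using integrable_process_square by (rule square_integrable_imp_integrable[rotated]) simp

lemma integrable_process_mult: "integrable M (\<lambda>\<omega>. X n \<omega> * X m \<omega>)"
proof (rule Bochner_Integration.integrable_bound)
  show "integrable M (\<lambda>\<omega>. (X n \<omega>)\<^sup>2 + (X m \<omega>)\<^sup>2)"
    by (intro Bochner_Integration.integrable_add integrable_process_square)
  have "\<bar>x * y\<bar> \<le> x\<^sup>2 + y\<^sup>2" for x y :: real
  proof -
    have "2 * (\<bar>x\<bar> * \<bar>y\<bar>) \<le> x\<^sup>2 + y\<^sup>2"
      using sum_squares_bound[of "\<bar>x\<bar>" "\<bar>y\<bar>"] by simp
    then show ?thesis
      unfolding abs_mult using mult_nonneg_nonneg[of "\<bar>x\<bar>" "\<bar>y\<bar>"] by linarith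
  qed
  then show "AE \<omega> in M. norm (X n \<omega> * X m \<omega>) \<le> norm ((X n \<omega>)\<^sup>2 + (X m \<omega>)\<^sup>2)"
    by simp
qed measurable

lemma expectation_square_linear_combination:
  "expectation (\<lambda>\<omega>. (\<Sum>n<N. c n * X n \<omega>)\<^sup>2)
     = (\<Sum>n<N. \<Sum>m<N. c n * c m * covariance_matrix M X n m)"
proof -
  \<comment> \<open>The factors are ordered as in \<open>covariance_matrix M X n m\<close>, where
    the variable with index \<open>m\<close> comes first.\<close>
  have "(\<Sum>n<N. c n * X n \<omega>)\<^sup>2 = (\<Sum>n<N. \<Sum>m<N. c n * c m * (X m \<omega> * X n \<omega>))" for \<omega>
    by (simp add: power2_eq_square sum_product mult_ac)
  then show ?thesis
    using centered
    by (simp add: integrable_process_mult covariance_matrix_def centered_def)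
qed

lemma expectation_linear_combination: "expectation (\<lambda>\<omega>. \<Sum>n<N. c n * X n \<omega>) = 0"
  using centered by (simp add: integrable_process centered_def)

text \<open>An even moment of a centered Gaussian variable is a constant times a power of its
  variance, hence monotone in the variance. The nonnegative integral is the form in which Fatou and
  Tonelli use the bound.\<close>

lemma linear_combination_even_moment_le:
  assumes "expectation (\<lambda>\<omega>. (\<Sum>n<N. c n * X n \<omega>)\<^sup>2) \<le> V"
  shows "(\<integral>\<^sup>+ \<omega>. ennreal ((\<Sum>n<N. c n * X n \<omega>) ^ (2 * k)) \<partial>M)
     \<le> ennreal (fact (2 * k) / (2 ^ k * fact k) * V ^ k)"
proof -
  have g: "gaussian_variable M (\<lambda>\<omega>. \<Sum>n<N. c n * X n \<omega>)"
    using gaussian by (simp add: gaussian_process_def)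
  have "(\<integral>\<^sup>+ \<omega>. ennreal ((\<Sum>n<N. c n * X n \<omega>) ^ (2 * k)) \<partial>M)
      = ennreal (expectation (\<lambda>\<omega>. (\<Sum>n<N. c n * X n \<omega>) ^ (2 * k)))"
    by (intro nn_integral_eq_integral integrable_gaussian_even_power g
        expectation_linear_combination) (simp add: power_mult)
  also have "\<dots> \<le> ennreal (fact (2 * k) / (2 ^ k * fact k) * V ^ k)"
    unfolding gaussian_even_moment[OF g expectation_linear_combination]
    by (intro ennreal_leI mult_left_mono power_mono assms) auto
  finally show ?thesis .
qed

end

text \<open>Gaussianity is available only for real combinations, so complex ones are split into real
  and imaginary parts. The estimate is \<open>x + y \<le> 2 * max x y\<close> applied to their
  squares.\<close>

lemma norm_even_power_le:
  "norm z ^ (2 * k) \<le> 2 ^ k * (Re z ^ (2 * k) + Im z ^ (2 * k))"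
proof -
  have "(x + y) ^ k \<le> 2 ^ k * (x ^ k + y ^ k)" if "0 \<le> x" "0 \<le> y" for x y :: real
  proof -
    have "(x + y) ^ k \<le> (2 * max x y) ^ k" using that by (intro power_mono) auto
    also have "\<dots> \<le> 2 ^ k * (x ^ k + y ^ k)"
      using that by (auto simp: power_mult_distrib max_def)
    finally show ?thesis .
  qed
  from this[of "(Re z)\<^sup>2" "(Im z)\<^sup>2"] show ?thesis
    by (simp add: power_mult cmod_power2)
qed

section \<open>Random power series\<close>

lemma measurable_cis [measurable]: "cis \<in> borel_measurable borel"
  by (intro borel_measurable_continuous_onI continuous_intros)

lemma sums_bounded_coeffs:
  fixes b :: "nat \<Rightarrow> complex"
  assumes b: "\<And>n. norm (b n) \<le> B" and z: "z \<in> ball 0 1"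
  shows "(\<lambda>n. b n * z ^ n) sums (\<Sum>n. b n * z ^ n)"
proof (rule summable_sums, rule summable_comparison_test')
  show "summable (\<lambda>n. B * norm z ^ n)"
    using z by (intro summable_mult summable_geometric) simp
  show "norm (b n * z ^ n) \<le> B * norm z ^ n" for n
    unfolding norm_mult norm_power by (intro mult_right_mono b) simp
qed

text \<open>Boundedness of the covariance operator enters the rest of the argument only through this
  second moment inequality.\<close>

locale bounded_gaussian_process = centered_gaussian_process +
  fixes C :: real
  assumes C_nonneg: "0 \<le> C"
    and second_moment_le: "expectation (\<lambda>\<omega>. (\<Sum>n<N. c n * X n \<omega>)\<^sup>2) \<le> C * (\<Sum>n<N. (c n)\<^sup>2)"
begin

text \<open>As \<open>suminf\<close> is total, the value is meaningful only where the series
  converges; for \<open>a\<close> in \<open>ell2\<close> this holds almost surely on the whole disk,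
  by \<open>AE_bounded_coeffs\<close> and \<open>sums_bounded_coeffs\<close>.\<close>

definition random_series :: "(nat \<Rightarrow> complex) \<Rightarrow> 'a \<Rightarrow> complex \<Rightarrow> complex" where
  "random_series a \<omega> z = (\<Sum>n. a n * of_real (X n \<omega>) * z ^ n)"

text \<open>Real and imaginary parts are real combinations with coefficients dominated by
  \<open>norm (b n)\<close>, so both have variance at most \<open>C * A\<close>. The factor
  \<open>2 ^ k\<close> comes from \<open>norm_even_power_le\<close>, the factor 2 from adding the
  two parts.\<close>

lemma complex_combination_even_moment_le:
  fixes b :: "nat \<Rightarrow> complex"
  assumes "(\<Sum>n<N. (norm (b n))\<^sup>2) \<le> A"
  shows "(\<integral>\<^sup>+ \<omega>. ennreal (norm (\<Sum>n<N. b n * of_real (X n \<omega>)) ^ (2 * k)) \<partial>M)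
    \<le> ennreal (2 ^ k * 2 * (fact (2 * k) / (2 ^ k * fact k) * (C * A) ^ k))"
proof -
  define D where "D = fact (2 * k) / (2 ^ k * fact k) * (C * A) ^ k"
  have "0 \<le> A" using assms sum_nonneg[of "{..<N}" "\<lambda>n. (norm (b n))\<^sup>2"] by simp
  then have D: "0 \<le> D" unfolding D_def using C_nonneg by simp
  have moment: "(\<integral>\<^sup>+ \<omega>. ennreal ((\<Sum>n<N. c n * X n \<omega>) ^ (2 * k)) \<partial>M) \<le> ennreal D"
    if c: "\<And>n. \<bar>c n\<bar> \<le> norm (b n)" for c
    unfolding D_def
  proof (rule linear_combination_even_moment_le, rule order_trans[OF second_moment_le])
    have "(\<Sum>n<N. (c n)\<^sup>2) \<le> (\<Sum>n<N. (norm (b n))\<^sup>2)"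
      by (intro sum_mono) (metis abs_ge_zero c power2_abs power_mono)
    then show "C * (\<Sum>n<N. (c n)\<^sup>2) \<le> C * A"
      using assms C_nonneg by (intro mult_left_mono) auto
  qed
  have "(\<integral>\<^sup>+ \<omega>. ennreal (norm (\<Sum>n<N. b n * of_real (X n \<omega>)) ^ (2 * k)) \<partial>M)
    \<le> (\<integral>\<^sup>+ \<omega>. ennreal (2 ^ k) * (ennreal ((\<Sum>n<N. Re (b n) * X n \<omega>) ^ (2 * k))
          + ennreal ((\<Sum>n<N. Im (b n) * X n \<omega>) ^ (2 * k))) \<partial>M)"
  proof (rule nn_integral_mono)
    fix \<omega>
    show "ennreal (norm (\<Sum>n<N. b n * of_real (X n \<omega>)) ^ (2 * k))
      \<le> ennreal (2 ^ k) * (ennreal ((\<Sum>n<N. Re (b n) * X n \<omega>) ^ (2 * k))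
          + ennreal ((\<Sum>n<N. Im (b n) * X n \<omega>) ^ (2 * k)))"
      using norm_even_power_le[of "\<Sum>n<N. b n * of_real (X n \<omega>)" k]
      by (subst ennreal_plus[symmetric], simp, simp, subst ennreal_mult[symmetric])
         (auto intro!: ennreal_leI)
  qed
  also have "\<dots> = ennreal (2 ^ k) * ((\<integral>\<^sup>+ \<omega>. ennreal ((\<Sum>n<N. Re (b n) * X n \<omega>) ^ (2 * k)) \<partial>M)
      + (\<integral>\<^sup>+ \<omega>. ennreal ((\<Sum>n<N. Im (b n) * X n \<omega>) ^ (2 * k)) \<partial>M))"
    by (simp add: nn_integral_cmult nn_integral_add)
  also have "\<dots> \<le> ennreal (2 ^ k) * (ennreal D + ennreal D)"
    by (intro mult_left_mono add_mono moment abs_Re_le_cmod abs_Im_le_cmod) simp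
  also have "\<dots> = ennreal (2 ^ k * 2 * D)"
    using D by (simp add: ennreal_mult mult_ac flip: ennreal_plus)
  finally show ?thesis unfolding D_def .
qed

text \<open>The expected value of the sum of \<open>norm (a n * X n) ^ 2\<close> is at most
  \<open>C\<close> times the squared \<open>ell2\<close> norm of \<open>a\<close>. Hence the sum is
  almost surely finite, and its terms tend to 0 and stay bounded.\<close>

lemma AE_bounded_coeffs:
  assumes a: "a \<in> ell2"
  shows "AE \<omega> in M. \<exists>B. \<forall>n. norm (a n * of_real (X n \<omega>)) \<le> B"
proof -
  \<comment> \<open>The unit vector at \<open>n\<close> is the test vector; \<open>Suc n\<close>
    terms are the fewest that contain it.\<close>
  have X2: "expectation (\<lambda>\<omega>. (X n \<omega>)\<^sup>2) \<le> C" for n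
    using second_moment_le[where N = "Suc n" and c = "\<lambda>m. if m = n then 1 else 0"]
    by (simp add: if_distrib[of "\<lambda>x. x * _"] if_distrib[of "\<lambda>x. x ^ _"] cong: if_cong)
  have nn: "(\<integral>\<^sup>+ \<omega>. ennreal ((norm (a n * of_real (X n \<omega>)))\<^sup>2) \<partial>M) \<le> ennreal ((norm (a n))\<^sup>2 * C)" for n
  proof -
    have "(\<integral>\<^sup>+ \<omega>. ennreal ((norm (a n * of_real (X n \<omega>)))\<^sup>2) \<partial>M)
        = (\<integral>\<^sup>+ \<omega>. ennreal ((norm (a n))\<^sup>2 * (X n \<omega>)\<^sup>2) \<partial>M)"
      by (simp add: norm_mult power_mult_distrib)
    also have "\<dots> = ennreal ((norm (a n))\<^sup>2 * expectation (\<lambda>\<omega>. (X n \<omega>)\<^sup>2))"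
      by (subst nn_integral_eq_integral) (auto simp: integrable_process_square)
    also have "\<dots> \<le> ennreal ((norm (a n))\<^sup>2 * C)"
      by (intro ennreal_leI mult_left_mono X2) auto
    finally show ?thesis .
  qed
  have "(\<integral>\<^sup>+ \<omega>. (\<Sum>n. ennreal ((norm (a n * of_real (X n \<omega>)))\<^sup>2)) \<partial>M)
      = (\<Sum>n. \<integral>\<^sup>+ \<omega>. ennreal ((norm (a n * of_real (X n \<omega>)))\<^sup>2) \<partial>M)"
    by (rule nn_integral_suminf) measurable
  also have "\<dots> \<le> (\<Sum>n. ennreal ((norm (a n))\<^sup>2 * C))"
    by (intro suminf_le nn summableI)
  also have "\<dots> = ennreal (\<Sum>n. (norm (a n))\<^sup>2 * C)"
    using a C_nonneg by (intro suminf_ennreal2 summable_mult2) (auto simp: ell2_def)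
  finally have "(\<integral>\<^sup>+ \<omega>. (\<Sum>n. ennreal ((norm (a n * of_real (X n \<omega>)))\<^sup>2)) \<partial>M) \<noteq> \<infinity>"
    by (auto simp: top_unique)
  then have "AE \<omega> in M. (\<Sum>n. ennreal ((norm (a n * of_real (X n \<omega>)))\<^sup>2)) \<noteq> \<infinity>"
    by (intro nn_integral_PInf_AE) measurable
  then show ?thesis
  proof eventually_elim
    case (elim \<omega>)
    have "summable (\<lambda>n. (norm (a n * of_real (X n \<omega>)))\<^sup>2)"
      using elim by (intro summable_suminf_not_top) auto
    then have "(\<lambda>n. sqrt ((norm (a n * of_real (X n \<omega>)))\<^sup>2)) \<longlonglongrightarrow> sqrt 0"
      by (intro tendsto_real_sqrt summable_LIMSEQ_zero)
    then have "Bseq (\<lambda>n. norm (a n * of_real (X n \<omega>)))"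
      by (intro convergent_imp_Bseq) (auto simp: convergent_def)
    then show ?case by (auto simp: Bseq_def)
  qed
qed

text \<open>Fatou for the partial sums. Since \<open>norm (z ^ n) \<le> 1\<close>, the bound is
  uniform over the disk.\<close>

lemma random_series_even_moment_le:
  assumes a: "a \<in> ell2" and z: "z \<in> ball 0 1"
  shows "(\<integral>\<^sup>+ \<omega>. ennreal (norm (random_series a \<omega> z) ^ (2 * k)) \<partial>M)
    \<le> ennreal (2 ^ k * 2 * (fact (2 * k) / (2 ^ k * fact k) * (C * (\<Sum>n. (norm (a n))\<^sup>2)) ^ k))"
    (is "_ \<le> ?D")
proof -
  define S where "S N \<omega> = (\<Sum>n<N. (a n * z ^ n) * of_real (X n \<omega>))" for N \<omega>
  have [measurable]: "S N \<in> borel_measurable M" for N unfolding S_def by measurable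
  have S: "(\<integral>\<^sup>+ \<omega>. ennreal (norm (S N \<omega>) ^ (2 * k)) \<partial>M) \<le> ?D" for N
    unfolding S_def
  proof (rule complex_combination_even_moment_le)
    have "(norm (a n * z ^ n))\<^sup>2 \<le> (norm (a n))\<^sup>2" for n
      using z by (intro power_mono) (auto simp: norm_mult norm_power power_le_one mult_left_le)
    then have "(\<Sum>n<N. (norm (a n * z ^ n))\<^sup>2) \<le> (\<Sum>n<N. (norm (a n))\<^sup>2)"
      by (intro sum_mono)
    also have "\<dots> \<le> (\<Sum>n. (norm (a n))\<^sup>2)"
      using a by (intro sum_le_suminf) (auto simp: ell2_def)
    finally show "(\<Sum>n<N. (norm (a n * z ^ n))\<^sup>2) \<le> (\<Sum>n. (norm (a n))\<^sup>2)" .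
  qed
  \<comment> \<open>Almost surely the coefficients are bounded, so the partial sums converge and the
    limit is the lower limit.\<close>
  have "AE \<omega> in M. ennreal (norm (random_series a \<omega> z) ^ (2 * k))
      = liminf (\<lambda>N. ennreal (norm (S N \<omega>) ^ (2 * k)))"
    using AE_bounded_coeffs[OF a]
  proof eventually_elim
    case (elim \<omega>)
    then obtain B where "\<And>n. norm (a n * of_real (X n \<omega>)) \<le> B" by blast
    then have "(\<lambda>n. a n * of_real (X n \<omega>) * z ^ n) sums (\<Sum>n. a n * of_real (X n \<omega>) * z ^ n)"
      using z by (rule sums_bounded_coeffs)
    then have "(\<lambda>N. S N \<omega>) \<longlonglongrightarrow> random_series a \<omega> z"
      by (simp add: sums_def S_def random_series_def mult_ac)
    then have "(\<lambda>N. ennreal (norm (S N \<omega>) ^ (2 * k)))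
        \<longlonglongrightarrow> ennreal (norm (random_series a \<omega> z) ^ (2 * k))"
      by (intro tendsto_ennrealI tendsto_intros)
    then show ?case by (intro lim_imp_Liminf[symmetric] sequentially_bot)
  qed
  then have "(\<integral>\<^sup>+ \<omega>. ennreal (norm (random_series a \<omega> z) ^ (2 * k)) \<partial>M)
      = (\<integral>\<^sup>+ \<omega>. liminf (\<lambda>N. ennreal (norm (S N \<omega>) ^ (2 * k))) \<partial>M)"
    by (rule nn_integral_cong_AE)
  also have "\<dots> \<le> liminf (\<lambda>N. \<integral>\<^sup>+ \<omega>. ennreal (norm (S N \<omega>) ^ (2 * k)) \<partial>M)"
    by (rule nn_integral_liminf) measurable
  also have "\<dots> \<le> ?D"
    by (intro Liminf_le always_eventually allI S) simp
  finally show ?thesis .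
qed

section \<open>Circle means of the random series and their almost sure boundedness\<close>

text \<open>Values in \<open>ennreal\<close> keep the mean meaningful for every outcome, including
  those where the series diverges, so it can be integrated over \<open>M\<close> before any
  exceptional set is removed.\<close>

definition circle_mean :: "nat \<Rightarrow> (nat \<Rightarrow> complex) \<Rightarrow> real \<Rightarrow> 'a \<Rightarrow> ennreal" where
  "circle_mean k a r \<omega> = (\<integral>\<^sup>+ t. ennreal (norm (random_series a \<omega> (of_real r * cis t)) ^ (2 * k))
     * indicator {0..2*pi} t \<partial>lborel)"

lemma measurable_random_series_circle [measurable]:
  "(\<lambda>(\<omega>, t). random_series a \<omega> (of_real r * cis t)) \<in> borel_measurable (M \<Otimes>\<^sub>M lborel)"
  unfolding random_series_def by measurable

lemma measurable_circle_mean [measurable]: "circle_mean k a r \<in> borel_measurable M"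
  unfolding circle_mean_def by measurable

text \<open>Tonelli exchanges the two integrals and the pointwise moment bound is integrated over an
  interval of length \<open>2 * pi\<close>. The point is that \<open>D\<close> is chosen before
  \<open>r\<close>.\<close>

lemma circle_mean_expectation_le:
  assumes a: "a \<in> ell2"
  obtains D :: real where "\<And>r. 0 \<le> r \<Longrightarrow> r < 1 \<Longrightarrow> (\<integral>\<^sup>+ \<omega>. circle_mean k a r \<omega> \<partial>M) \<le> ennreal D"
proof -
  define D where "D = 2 ^ k * 2 * (fact (2 * k) / (2 ^ k * fact k) * (C * (\<Sum>n. (norm (a n))\<^sup>2)) ^ k)"
  interpret pair_sigma_finite M lborel ..
  have "(\<integral>\<^sup>+ \<omega>. circle_mean k a r \<omega> \<partial>M) \<le> ennreal (D * (2 * pi))" if r: "0 \<le> r" "r < 1" for r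
  proof -
    have "(\<integral>\<^sup>+ \<omega>. circle_mean k a r \<omega> \<partial>M) = (\<integral>\<^sup>+ t. \<integral>\<^sup>+ \<omega>.
        ennreal (norm (random_series a \<omega> (of_real r * cis t)) ^ (2 * k)) * indicator {0..2*pi} t \<partial>M \<partial>lborel)"
      unfolding circle_mean_def by (intro Fubini'[symmetric]) measurable
    also have "\<dots> \<le> (\<integral>\<^sup>+ t. ennreal D * indicator {0..2*pi} t \<partial>lborel)"
    proof (rule nn_integral_mono)
      fix t :: real
      have "(\<integral>\<^sup>+ \<omega>. ennreal (norm (random_series a \<omega> (of_real r * cis t)) ^ (2 * k)) \<partial>M) \<le> ennreal D"
        unfolding D_def using r by (intro random_series_even_moment_le a) (simp add: norm_mult)
      then show "(\<integral>\<^sup>+ \<omega>. ennreal (norm (random_series a \<omega> (of_real r * cis t)) ^ (2 * k))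
          * indicator {0..2*pi} t \<partial>M) \<le> ennreal D * indicator {0..2*pi} t"
        by (auto split: split_indicator)
    qed
    also have "\<dots> = ennreal (D * (2 * pi))"
      by (simp add: nn_integral_cmult_indicator ennreal_mult'')
    finally show ?thesis .
  qed
  then show ?thesis using that by blast
qed

lemma AE_random_series_hardy_space:
  assumes a: "a \<in> ell2" and p: "0 < p"
  shows "AE \<omega> in M. \<exists>g\<in>hardy_space p.
          \<forall>z\<in>ball 0 1. (\<lambda>n. a n * of_real (X n \<omega>) * z ^ n) sums g z"
proof -
  obtain k :: nat where k: "p \<le> real (2 * k)"
    using real_arch_simple[of p] by (metis le_add2 mult_2 of_nat_le_iff order_trans)
  \<comment> \<open>Radii 1/2, 2/3, 3/4 and so on. A countable sequence lets one null set serve all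
    radii at once.\<close>
  define \<rho> where "\<rho> j = real (Suc j) / real (Suc (Suc j))" for j
  have \<rho>: "0 \<le> \<rho> j" "\<rho> j < 1" "i \<le> j \<Longrightarrow> \<rho> i \<le> \<rho> j" for i j
    by (auto simp: \<rho>_def field_simps)
  have \<rho>_lim: "\<rho> \<longlonglongrightarrow> 1"
    unfolding \<rho>_def using LIMSEQ_Suc[OF LIMSEQ_n_over_Suc_n] by simp
  obtain D where D: "\<And>r. 0 \<le> r \<Longrightarrow> r < 1 \<Longrightarrow> (\<integral>\<^sup>+ \<omega>. circle_mean k a r \<omega> \<partial>M) \<le> ennreal D"
    using circle_mean_expectation_le[OF a] by blast
  \<comment> \<open>Fatou requires no monotonicity in the radius, which is at hand only for outcomes
    where the series defines a holomorphic function.\<close>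
  have "(\<integral>\<^sup>+ \<omega>. liminf (\<lambda>j. circle_mean k a (\<rho> j) \<omega>) \<partial>M)
      \<le> liminf (\<lambda>j. \<integral>\<^sup>+ \<omega>. circle_mean k a (\<rho> j) \<omega> \<partial>M)"
    by (rule nn_integral_liminf) measurable
  also have "\<dots> \<le> ennreal D"
    by (intro Liminf_le always_eventually allI D \<rho>) simp
  finally have "(\<integral>\<^sup>+ \<omega>. liminf (\<lambda>j. circle_mean k a (\<rho> j) \<omega>) \<partial>M) \<noteq> \<infinity>"
    by (auto simp: top_unique)
  then have "AE \<omega> in M. liminf (\<lambda>j. circle_mean k a (\<rho> j) \<omega>) \<noteq> \<infinity>"
    by (intro nn_integral_PInf_AE) measurable
  with AE_bounded_coeffs[OF a] show ?thesis
  proof eventually_elim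
    case (elim \<omega>)
    then obtain B where B: "\<And>n. norm (a n * of_real (X n \<omega>)) \<le> B" by blast
    let ?F = "random_series a \<omega>"
    define J where "J r = (LINT t:{0..2*pi}|lborel. norm (?F (of_real r * cis t)) ^ (2 * k))" for r
    define L where "L = liminf (\<lambda>j. circle_mean k a (\<rho> j) \<omega>)"
    have sums: "(\<lambda>n. a n * of_real (X n \<omega>) * z ^ n) sums ?F z" if "z \<in> ball 0 1" for z
      unfolding random_series_def using B that by (rule sums_bounded_coeffs)
    then have hol: "?F holomorphic_on ball 0 1"
      by (intro power_series_holomorphic[where a = "\<lambda>n. a n * of_real (X n \<omega>)"]) auto
    have mono: "J r \<le> J s" if "0 \<le> r" "r \<le> s" "s < 1" for r s
      unfolding J_def using hol that by (rule integral_mean_even_mono)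
    \<comment> \<open>For a good outcome the \<open>ennreal\<close> mean is finite and equals the
      Bochner integral used in \<open>hardy_space\<close>.\<close>
    have mean: "circle_mean k a r \<omega> = ennreal (J r)" if "0 \<le> r" "r < 1" for r
    proof -
      have "set_integrable lborel {0..2*pi} (\<lambda>t. norm (?F (of_real r * cis t)) ^ (2 * k))"
        using that by (intro set_integrable_norm_circle[OF hol, where h = "\<lambda>x. x ^ (2 * k)"]
            continuous_intros) auto
      then have "(\<integral>\<^sup>+ t. ennreal (indicator {0..2*pi} t *\<^sub>R norm (?F (of_real r * cis t)) ^ (2 * k)) \<partial>lborel)
          = ennreal (J r)"
        unfolding J_def set_lebesgue_integral_def set_integrable_def
        by (intro nn_integral_eq_integral) auto
      moreover have "ennreal (indicator {0..2*pi} t *\<^sub>R x) = ennreal x * indicator {0..2*pi} t" for t x :: real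
        by (auto split: split_indicator)
      ultimately show ?thesis by (simp add: circle_mean_def)
    qed
    \<comment> \<open>Eventually \<open>\<rho> j\<close> exceeds \<open>r\<close>, so monotonicity
      puts \<open>J r\<close> below the lower limit \<open>L\<close>. Finiteness of \<open>L\<close>
      ensures that \<open>enn2real\<close> does not return its default value 0.\<close>
    have "J r \<le> enn2real L" if r: "0 < r" "r < 1" for r
    proof -
      have "\<forall>\<^sub>F j in sequentially. r < \<rho> j"
        using \<rho>_lim r by (simp add: order_tendstoD)
      then have "\<forall>\<^sub>F j in sequentially. ennreal (J r) \<le> circle_mean k a (\<rho> j) \<omega>"
        by eventually_elim (use r \<rho> in \<open>auto simp: mean intro!: ennreal_leI mono\<close>)
      then have "ennreal (J r) \<le> L"
        unfolding L_def by (rule Liminf_bounded)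
      moreover have "0 \<le> J r"
        unfolding J_def set_lebesgue_integral_def by (intro integral_nonneg_AE) auto
      ultimately show ?thesis
        using elim by (metis L_def enn2real_ennreal enn2real_mono infinity_ennreal_def top.not_eq_extremum)
    qed
    then have "?F \<in> hardy_space p"
      unfolding J_def by (intro hardy_spaceI_even_means[OF hol p k]) auto
    then show ?case using sums by blast
  qed
qed

end

theorem theorem2:
  fixes M :: "'a measure" and X :: "nat \<Rightarrow> 'a \<Rightarrow> real"
  assumes "prob_space M"
    and "gaussian_process M X"
    and "centered M X"
    and "bounded_on_ell2 (covariance_matrix M X)"
  shows "L_property M X"
proof -
  interpret centered_gaussian_process M X
    using assms by (simp add: centered_gaussian_process_def centered_gaussian_process_axioms_def)
  obtain C where C: "0 \<le> C" "\<And>(c :: nat \<Rightarrow> real) N.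
      (\<Sum>n<N. \<Sum>m<N. c n * c m * covariance_matrix M X n m) \<le> C * (\<Sum>n<N. (c n)\<^sup>2)"
    using bounded_on_ell2_quadratic_form[OF assms(4)] by blast
  \<comment> \<open>The second moment of a combination is exactly the quadratic form of the
    covariance matrix, so the form bound supplies the constant.\<close>
  interpret bounded_gaussian_process M X C
    by unfold_locales (auto simp: expectation_square_linear_combination C)
  show ?thesis
    unfolding L_property_def Lp_property_def
    using AE_random_series_hardy_space hardy_space_2_coeffs_ell2 by blast
qed

end
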